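(* Let $T_0$ be a closed, symmetric (densely defined) operator in a complex Hilbert space $H$ with equal, finite deficiency indices $\mathrm{def}(T_0)\ge1$, and let $T_1=T_0^*$ (so $T_1^*=T_0$). Let $W$ be a finite-dimensional complex inner product space with $\dim W\le\mathrm{def}(T_0)$, with orthonormal basis $\{\xi_j\mid j=1,\ldots,\dim W\}$, let $\{t_j\mid j=1,\ldots,\dim W\}\subseteq\mathcal D(T_1)$ be a partial GKN set for $T_0$, and let $B:W\to W$ be self-adjoint. Let $\widehat T_0$ and $\widehat T_1=(\widehat T_0)^*$ be the minimal and maximal operators in $H\oplus W$ defined in the context, and put $$X_\pm=\{x\in\mathcal D(T_1)\mid T_1x=\pm ix\},\qquad Y_\pm=\{(x,a)\in\mathcal D(\widehat T_1)\mid\widehat T_1(x,a)=\pm i(x,a)\}.$$ Then $(x,a)\in Y_\pm$ if and only if $x\in X_\pm$ and $a=(B\mp iI)^{-1}\Omega x$ (upper signs together, lower signs together). Moreover, the deficiency indices of $\widehat T_0$ are equal and finite and satisfy $\mathrm{def}(\widehat T_0)=\mathrm{def}(T_0)$.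
   Context: $\mathrm{def}(T_0)$ is the common value of $\dim X_+$ and $\dim X_-$; the deficiency indices of $\widehat T_0$ are $\dim Y_+$ and $\dim Y_-$, and $\mathrm{def}(\widehat T_0)$ is their common value when equal. $[x,y]_H:=\langle T_1x,y\rangle_H-\langle x,T_1y\rangle_H$ for $x,y\in\mathcal D(T_1)$ (inner products linear in the first argument). A partial GKN set here is a set $\{t_j\mid j=1,\ldots,\dim W\}\subseteq\mathcal D(T_1)$ such that $\sum_j\alpha_jt_j\in\mathcal D(T_0)$ implies all $\alpha_j=0$, and $[t_i,t_j]_H=0$ for all $i,j$. $\Delta_0:=\mathcal D(T_0)+\mathrm{span}\{t_j\mid j=1,\ldots,\dim W\}$; $\Psi:\Delta_0\to W$ is the linear map $\Psi\big(s+\sum_j\alpha_jt_j\big)=\sum_j\alpha_j\xi_j$ for $s\in\mathcal D(T_0)$, $\alpha_j\in\mathbb C$; $\Omega:\mathcal D(T_1)\to W$ is the linear map $\Omega x=\sum_{j=1}^{\dim W}[x,t_j]_H\,\xi_j$. $H\oplus W$ is the Hilbert space of pairs $(x,a)$, $x\in H$, $a\in W$, with $\langle (x,a),(y,b)\rangle_{H\oplus W}=\langle x,y\rangle_H+\langle a,b\rangle_W$. Minimal operator: $\mathcal D(\widehat T_0)=\{(x,\Psi x)\mid x\in\Delta_0\}$, $\widehat T_0(x,a)=(T_1x,Ba)$. Maximal operator: $\mathcal D(\widehat T_1)=\{(x,a)\mid x\in\mathcal D(T_1),\ a\in W\}$, $\widehat T_1(x,a)=(T_1x,\,Ba-\Omega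 x)$. *)

theory Defs
  imports "HOL-Analysis.Analysis"
begin

section \<open>Complex inner product spaces\<close>

text \<open>The inner product is linear in its first argument.  Positive definiteness is contained in
  the last axiom, since the norm is positive definite.\<close>

class complex_inner = real_normed_vector +
  fixes scaleC :: "complex \<Rightarrow> 'a \<Rightarrow> 'a"  (infixr \<open>*\<^sub>C\<close> 75)
    and cinner :: "'a \<Rightarrow> 'a \<Rightarrow> complex"
  assumes scaleC_add_right: "c *\<^sub>C (x + y) = c *\<^sub>C x + c *\<^sub>C y"
    and scaleC_add_left: "(c + d) *\<^sub>C x = c *\<^sub>C x + d *\<^sub>C x"
    and scaleC_scaleC: "c *\<^sub>C (d *\<^sub>C x) = (c * d) *\<^sub>C x"
    and scaleR_scaleC: "r *\<^sub>R x = complex_of_real r *\<^sub>C x"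
    and cinner_commute: "cinner x y = cnj (cinner y x)"
    and cinner_add_left: "cinner (x + y) z = cinner x z + cinner y z"
    and cinner_scaleC_left: "cinner (c *\<^sub>C x) y = c * cinner x y"
    and cinner_self: "cinner x x = complex_of_real ((norm x)\<^sup>2)"

class complex_hilbert = complex_inner + complete_space

lemma scaleC_one: "1 *\<^sub>C x = (x :: 'a :: complex_inner)"
  using scaleR_scaleC[of 1 x] by simp

global_interpretation complex_vector: vector_space "scaleC :: complex \<Rightarrow> 'a \<Rightarrow> 'a :: complex_inner"
  by unfold_locales (simp_all add: scaleC_add_right scaleC_add_left scaleC_scaleC scaleC_one)

definition finite_cdim :: "'a :: complex_inner set \<Rightarrow> bool" where
  "finite_cdim V \<longleftrightarrow> (\<exists>b. finite b \<and> V \<subseteq> complex_vector.span b)"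

definition orthonormal_basis :: "nat \<Rightarrow> (nat \<Rightarrow> 'w :: complex_inner) \<Rightarrow> bool" where
  "orthonormal_basis n \<xi> \<longleftrightarrow>
     (\<forall>i\<in>{1..n}. \<forall>j\<in>{1..n}. cinner (\<xi> i) (\<xi> j) = (if i = j then 1 else 0)) \<and>
     complex_vector.span (\<xi> ` {1..n}) = UNIV"

text \<open>The orthogonal sum \<open>H \<oplus> W\<close> is the product type; the norm of the library on products is
  the one induced by the sum of the inner products.\<close>

instantiation prod :: (complex_inner, complex_inner) complex_inner
begin

definition scaleC_prod :: "complex \<Rightarrow> 'a \<times> 'b \<Rightarrow> 'a \<times> 'b" where
  "c *\<^sub>C u = (c *\<^sub>C fst u, c *\<^sub>C snd u)"

definition cinner_prod :: "'a \<times> 'b \<Rightarrow> 'a \<times> 'b \<Rightarrow> complex" where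
  "cinner u v = cinner (fst u) (fst v) + cinner (snd u) (snd v)"

instance
proof
  fix c d :: complex and r :: real and x y z :: "'a \<times> 'b"
  show "c *\<^sub>C (x + y) = c *\<^sub>C x + c *\<^sub>C y"
    by (simp add: scaleC_prod_def scaleC_add_right)
  show "(c + d) *\<^sub>C x = c *\<^sub>C x + d *\<^sub>C x"
    by (simp add: scaleC_prod_def scaleC_add_left)
  show "c *\<^sub>C (d *\<^sub>C x) = (c * d) *\<^sub>C x"
    by (simp add: scaleC_prod_def scaleC_scaleC)
  show "r *\<^sub>R x = complex_of_real r *\<^sub>C x"
    by (simp add: scaleC_prod_def scaleR_prod_def scaleR_scaleC)
  show "cinner x y = cnj (cinner y x)"
    by (simp add: cinner_prod_def cinner_commute[symmetric])
  show "cinner (x + y) z = cinner x z + cinner y z"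
    by (simp add: cinner_prod_def cinner_add_left)
  show "cinner (c *\<^sub>C x) y = c * cinner x y"
    by (simp add: cinner_prod_def scaleC_prod_def cinner_scaleC_left distrib_left)
  show "cinner x x = complex_of_real ((norm x)\<^sup>2)"
    by (simp add: cinner_prod_def norm_prod_def cinner_self)
qed

end


section \<open>Unbounded operators\<close>

text \<open>An operator is a partial function, so that equality of operators includes equality of
  domains.\<close>

definition linear_op :: "('a :: complex_inner \<rightharpoonup> 'a) \<Rightarrow> bool" where
  "linear_op T \<longleftrightarrow> complex_vector.subspace (dom T) \<and>
     (\<forall>x\<in>dom T. \<forall>y\<in>dom T. the (T (x + y)) = the (T x) + the (T y)) \<and>
     (\<forall>x\<in>dom T. \<forall>c. the (T (c *\<^sub>C x)) = c *\<^sub>C the (T x))"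

definition densely_defined :: "('a :: complex_inner \<rightharpoonup> 'a) \<Rightarrow> bool" where
  "densely_defined T \<longleftrightarrow> closure (dom T) = UNIV"

definition closed_op :: "('a :: complex_inner \<rightharpoonup> 'a) \<Rightarrow> bool" where
  "closed_op T \<longleftrightarrow> closed (Map.graph T)"

definition symmetric_op :: "('a :: complex_inner \<rightharpoonup> 'a) \<Rightarrow> bool" where
  "symmetric_op T \<longleftrightarrow> linear_op T \<and> densely_defined T \<and>
     (\<forall>x\<in>dom T. \<forall>y\<in>dom T. cinner (the (T x)) y = cinner x (the (T y)))"

text \<open>For densely defined \<open>T\<close> the vector \<open>z\<close> below is unique.\<close>

definition adjoint_op :: "('a :: complex_inner \<rightharpoonup> 'a) \<Rightarrow> ('a \<rightharpoonup> 'a)" where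
  "adjoint_op T = (\<lambda>y.
     if \<exists>z. \<forall>x\<in>dom T. cinner (the (T x)) y = cinner x z
     then Some (THE z. \<forall>x\<in>dom T. cinner (the (T x)) y = cinner x z)
     else None)"

definition selfadjoint_map :: "('w :: complex_inner \<Rightarrow> 'w) \<Rightarrow> bool" where
  "selfadjoint_map B \<longleftrightarrow> Vector_Spaces.linear scaleC scaleC B \<and>
     (\<forall>a b. cinner (B a) b = cinner a (B b))"

definition eigenspace_op :: "('a :: complex_inner \<rightharpoonup> 'a) \<Rightarrow> complex \<Rightarrow> 'a set" where
  "eigenspace_op T c = {x \<in> dom T. the (T x) = c *\<^sub>C x}"

text \<open>Since \<open>complex_vector.dim\<close> vanishes on infinite-dimensional spaces, finiteness of the
  deficiency indices is recorded separately.  The number \<open>deficiency T\<close> is meaningful only if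
  the deficiency indices are equal and finite.\<close>

definition equal_finite_deficiency :: "('a :: complex_inner \<rightharpoonup> 'a) \<Rightarrow> bool" where
  "equal_finite_deficiency T \<longleftrightarrow>
     finite_cdim (eigenspace_op (adjoint_op T) \<i>) \<and>
     finite_cdim (eigenspace_op (adjoint_op T) (- \<i>)) \<and>
     complex_vector.dim (eigenspace_op (adjoint_op T) \<i>) =
     complex_vector.dim (eigenspace_op (adjoint_op T) (- \<i>))"

definition deficiency :: "('a :: complex_inner \<rightharpoonup> 'a) \<Rightarrow> nat" where
  "deficiency T = complex_vector.dim (eigenspace_op (adjoint_op T) \<i>)"


section \<open>Extension to \<open>H \<oplus> W\<close>\<close>

text \<open>The form \<open>[x, y]\<^sub>H\<close>, for \<open>x\<close> and \<open>y\<close> in the domain of \<open>T1\<close>.\<close>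

definition bracket :: "('h :: complex_inner \<rightharpoonup> 'h) \<Rightarrow> 'h \<Rightarrow> 'h \<Rightarrow> complex" where
  "bracket T1 x y = cinner (the (T1 x)) y - cinner x (the (T1 y))"

definition partial_GKN ::
  "('h :: complex_inner \<rightharpoonup> 'h) \<Rightarrow> ('h \<rightharpoonup> 'h) \<Rightarrow> nat \<Rightarrow> (nat \<Rightarrow> 'h) \<Rightarrow> bool" where
  "partial_GKN T0 T1 n t \<longleftrightarrow>
     (\<forall>j\<in>{1..n}. t j \<in> dom T1) \<and>
     (\<forall>\<alpha>. (\<Sum>j=1..n. \<alpha> j *\<^sub>C t j) \<in> dom T0 \<longrightarrow> (\<forall>j\<in>{1..n}. \<alpha> j = 0)) \<and>
     (\<forall>i\<in>{1..n}. \<forall>j\<in>{1..n}. bracket T1 (t i) (t j) = 0)"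

definition Delta0 :: "('h :: complex_inner \<rightharpoonup> 'h) \<Rightarrow> nat \<Rightarrow> (nat \<Rightarrow> 'h) \<Rightarrow> 'h set" where
  "Delta0 T0 n t = {s + u | s u. s \<in> dom T0 \<and> u \<in> complex_vector.span (t ` {1..n})}"

text \<open>For a partial GKN set the coefficients \<open>\<alpha> j\<close> with \<open>1 \<le> j \<le> n\<close> in the decomposition of
  \<open>x \<in> Delta0\<close> are unique.\<close>

definition Psi ::
  "('h :: complex_inner \<rightharpoonup> 'h) \<Rightarrow> nat \<Rightarrow> (nat \<Rightarrow> 'h) \<Rightarrow> (nat \<Rightarrow> 'w :: complex_inner) \<Rightarrow> 'h \<Rightarrow> 'w"
where
  "Psi T0 n t \<xi> x = (THE w. \<exists>s\<in>dom T0. \<exists>\<alpha>.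
     x = s + (\<Sum>j=1..n. \<alpha> j *\<^sub>C t j) \<and> w = (\<Sum>j=1..n. \<alpha> j *\<^sub>C \<xi> j))"

definition Omega ::
  "('h :: complex_inner \<rightharpoonup> 'h) \<Rightarrow> nat \<Rightarrow> (nat \<Rightarrow> 'h) \<Rightarrow> (nat \<Rightarrow> 'w :: complex_inner) \<Rightarrow> 'h \<Rightarrow> 'w"
where
  "Omega T1 n t \<xi> x = (\<Sum>j=1..n. bracket T1 x (t j) *\<^sub>C \<xi> j)"

definition minimal_op ::
  "('h :: complex_inner \<rightharpoonup> 'h) \<Rightarrow> ('h \<rightharpoonup> 'h) \<Rightarrow> nat \<Rightarrow> (nat \<Rightarrow> 'h) \<Rightarrow>
   (nat \<Rightarrow> 'w :: complex_inner) \<Rightarrow> ('w \<Rightarrow> 'w) \<Rightarrow> ('h \<times> 'w \<rightharpoonup> 'h \<times> 'w)"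
where
  "minimal_op T0 T1 n t \<xi> B = (\<lambda>(x, a).
     if x \<in> Delta0 T0 n t \<and> a = Psi T0 n t \<xi> x then Some (the (T1 x), B a) else None)"

definition maximal_op ::
  "('h :: complex_inner \<rightharpoonup> 'h) \<Rightarrow> nat \<Rightarrow> (nat \<Rightarrow> 'h) \<Rightarrow>
   (nat \<Rightarrow> 'w :: complex_inner) \<Rightarrow> ('w \<Rightarrow> 'w) \<Rightarrow> ('h \<times> 'w \<rightharpoonup> 'h \<times> 'w)"
where
  "maximal_op T1 n t \<xi> B = (\<lambda>(x, a).
     if x \<in> dom T1 then Some (the (T1 x), B a - Omega T1 n t \<xi> x) else None)"

end

theory Submission
  imports Defs
begin

text \<open>Testing the relation defining the adjoint of \<open>That0\<close> at \<open>(y, b)\<close> against \<open>(s, 0)\<close> with \<open>s\<close> in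
  the domain of \<open>T0\<close> and against \<open>(t j, \<xi> j)\<close> shows that \<open>y\<close> lies in the domain of \<open>T1\<close> and that the
  value is \<open>(T1 y, B b - \<Omega> y)\<close>.  The eigenvalue equation for \<open>\<plusminus>\<i>\<close> then splits into \<open>T1 x = \<plusminus>\<i> x\<close>
  and \<open>(B \<mp> \<i>) a = \<Omega> x\<close>, and \<open>B \<mp> \<i>\<close> is invertible since \<open>B\<close> is self-adjoint on a
  finite-dimensional space.  So the eigenspaces of \<open>That1\<close> are graphs over those of \<open>T1\<close>, and the
  first projection preserves dimensions.\<close>

section \<open>Inner products and linear maps\<close>

lemma cinner_zero_left [simp]: "cinner 0 y = 0"
  for y :: "'a :: complex_inner"
  using cinner_add_left[of 0 0 y] by simp

lemma cinner_add_right: "cinner x (y + z) = cinner x y + cinner x z"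
  for x :: "'a :: complex_inner"
  by (metis cinner_add_left cinner_commute complex_cnj_add)

lemma cinner_zero_right [simp]: "cinner x 0 = 0"
  for x :: "'a :: complex_inner"
  using cinner_add_right[of x 0 0] by simp

lemma cinner_scaleC_right: "cinner x (c *\<^sub>C y) = cnj c * cinner x y"
  for x :: "'a :: complex_inner"
  by (metis cinner_scaleC_left cinner_commute complex_cnj_mult)

lemma cinner_diff_left: "cinner (x - y) z = cinner x z - cinner y z"
  for x :: "'a :: complex_inner"
  using cinner_add_left[of "x - y" y z] by simp

lemma cinner_diff_right: "cinner x (y - z) = cinner x y - cinner x z"
  for x :: "'a :: complex_inner"
  using cinner_add_right[of x "y - z" z] by simp

lemma cinner_sum_left: "cinner (\<Sum>j\<in>A. f j) y = (\<Sum>j\<in>A. cinner (f j) y)"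
  for y :: "'a :: complex_inner"
  by (induction A rule: infinite_finite_induct) (simp_all add: cinner_add_left)

lemma cinner_sum_right: "cinner x (\<Sum>j\<in>A. f j) = (\<Sum>j\<in>A. cinner x (f j))"
  for x :: "'a :: complex_inner"
  by (induction A rule: infinite_finite_induct) (simp_all add: cinner_add_right)

lemma cinner_self_eq_0_iff [simp]: "cinner x x = 0 \<longleftrightarrow> x = 0"
  for x :: "'a :: complex_inner"
  by (simp add: cinner_self)

section \<open>Vanishing of a vector by orthogonality\<close>

text \<open>By Pythagoras, a vector \<open>x\<close> orthogonal to \<open>z\<close> has distance at
  least \<open>norm z\<close> from \<open>z\<close>, so for nonzero \<open>z\<close> no point of
  \<open>D\<close> could come closer than that, against density.\<close>

lemma orthogonal_to_dense_eq_0: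
  fixes z :: "'a :: complex_inner"
  assumes "closure D = UNIV" and orth: "\<And>x. x \<in> D \<Longrightarrow> cinner x z = 0"
  shows "z = 0"
proof (rule ccontr)
  assume "z \<noteq> 0"
  then obtain x where x: "x \<in> D" "dist x z < norm z"
    using assms(1) closure_approachable[of z D] by (metis UNIV_I zero_less_norm_iff)
  have "cinner z x = 0"
    using orth[OF x(1)] cinner_commute[of z x] by simp
  then have "cinner (x - z) (x - z) = cinner x x + cinner z z"
    using orth[OF x(1)] by (simp add: cinner_diff_left cinner_diff_right)
  then have "complex_of_real ((norm (x - z))\<^sup>2) = complex_of_real ((norm x)\<^sup>2 + (norm z)\<^sup>2)"
    by (simp add: cinner_self)
  then have "(norm (x - z))\<^sup>2 = (norm x)\<^sup>2 + (norm z)\<^sup>2"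
    by (simp only: of_real_eq_iff)
  then have "(norm z)\<^sup>2 \<le> (norm (x - z))\<^sup>2"
    by simp
  then show False
    using x(2) by (simp add: dist_norm power2_le_iff_abs_le)
qed

lemma orthonormal_basis_cinner:
  "orthonormal_basis n \<xi> \<Longrightarrow> i \<in> {1..n} \<Longrightarrow> j \<in> {1..n} \<Longrightarrow>
    cinner (\<xi> i) (\<xi> j) = (if i = j then 1 else 0)"
  by (simp add: orthonormal_basis_def)

text \<open>The vectors orthogonal to \<open>w\<close> form a subspace; containing the basis, it
  contains \<open>w\<close> itself.\<close>

lemma orthogonal_to_orthonormal_basis_eq_0:
  assumes "orthonormal_basis n \<xi>" and "\<And>j. j \<in> {1..n} \<Longrightarrow> cinner (\<xi> j) w = 0"
  shows "w = 0"
proof -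
  have "complex_vector.subspace {v. cinner v w = 0}"
    by (simp add: complex_vector.subspace_def cinner_add_left cinner_scaleC_left)
  then have "complex_vector.span (\<xi> ` {1..n}) \<subseteq> {v. cinner v w = 0}"
    using assms(2) by (intro complex_vector.span_minimal) auto
  moreover have "w \<in> complex_vector.span (\<xi> ` {1..n})"
    using assms(1) by (simp add: orthonormal_basis_def)
  ultimately have "cinner w w = 0"
    by blast
  then show ?thesis
    by simp
qed

section \<open>Complex linear maps, spans and dimensions\<close>

lemma vector_space_pair_scaleC:
  "vector_space_pair (scaleC :: complex \<Rightarrow> 'a :: complex_inner \<Rightarrow> 'a)
    (scaleC :: complex \<Rightarrow> 'b :: complex_inner \<Rightarrow> 'b)"
  by (intro vector_space_pair.intro complex_vector.vector_space_axioms)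

lemma linear_scaleC_iff:
  "Vector_Spaces.linear scaleC scaleC f \<longleftrightarrow>
    (\<forall>x y. f (x + y) = f x + f y) \<and> (\<forall>c x. f (c *\<^sub>C x) = c *\<^sub>C f x)"
  for f :: "'a :: complex_inner \<Rightarrow> 'b :: complex_inner"
  by (simp add: Vector_Spaces.linear_iff complex_vector.vector_space_axioms)

lemma sum_delta_scaleC:
  "finite A \<Longrightarrow> k \<in> A \<Longrightarrow> (\<Sum>j\<in>A. (if j = k then 1 else 0) *\<^sub>C f j) = (f k :: 'a :: complex_inner)"
  by (subst sum.remove[of A k]) (auto simp: scaleC_one intro!: sum.neutral)

lemma sum_delta_mult:
  fixes f :: "'i \<Rightarrow> complex"
  shows "finite A \<Longrightarrow> k \<in> A \<Longrightarrow> (\<Sum>j\<in>A. (if j = k then 1 else 0) * f j) = f k"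
  by (subst sum.remove[of A k]) (auto intro!: sum.neutral)

text \<open>Coefficients are attached to indices rather than to vectors, so repeated values of
  \<open>t\<close> do no harm and the sums have the shape used in \<open>Psi\<close> and
  \<open>partial_GKN\<close>.\<close>

lemma span_image_eq_sums:
  fixes t :: "'i \<Rightarrow> 'a :: complex_inner"
  assumes "finite A"
  shows "complex_vector.span (t ` A) = {u. \<exists>\<alpha>. u = (\<Sum>j\<in>A. \<alpha> j *\<^sub>C t j)}" (is "_ = ?R")
proof
  have "complex_vector.subspace ?R"
    unfolding complex_vector.subspace_def
  proof (safe; (simp only: mem_Collect_eq)?)
    show "\<exists>\<alpha>. 0 = (\<Sum>j\<in>A. \<alpha> j *\<^sub>C t j)"
      by (rule exI[of _ "\<lambda>_. 0"]) simp
    show "\<exists>\<gamma>. (\<Sum>j\<in>A. \<alpha> j *\<^sub>C t j) + (\<Sum>j\<in>A. \<beta> j *\<^sub>C t j) = (\<Sum>j\<in>A. \<gamma> j *\<^sub>C t j)" for \<alpha> \<beta>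
      by (rule exI[of _ "\<lambda>j. \<alpha> j + \<beta> j"]) (simp add: scaleC_add_left sum.distrib)
    show "\<exists>\<gamma>. c *\<^sub>C (\<Sum>j\<in>A. \<alpha> j *\<^sub>C t j) = (\<Sum>j\<in>A. \<gamma> j *\<^sub>C t j)" for c \<alpha>
      by (rule exI[of _ "\<lambda>j. c * \<alpha> j"]) (simp add: scaleC_scaleC complex_vector.scale_sum_right)
  qed
  moreover have "t k \<in> ?R" if "k \<in> A" for k
  proof -
    have "t k = (\<Sum>j\<in>A. (if j = k then 1 else 0) *\<^sub>C t j)"
      using that \<open>finite A\<close> by (simp only: sum_delta_scaleC)
    then show ?thesis
      by (intro CollectI exI)
  qed
  ultimately show "complex_vector.span (t ` A) \<subseteq> ?R"
    by (intro complex_vector.span_minimal) auto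
  show "?R \<subseteq> complex_vector.span (t ` A)"
    by (auto intro: complex_vector.span_sum complex_vector.span_scale complex_vector.span_base)
qed

text \<open>A maximal independent set is finite because its size is bounded by that of a finite
  spanning set; with it as basis, injectivity forces surjectivity.\<close>

lemma linear_inj_imp_bij_finite_cdim:
  fixes f :: "'w :: complex_inner \<Rightarrow> 'w"
  assumes fin: "finite_cdim (UNIV :: 'w set)"
    and f: "Vector_Spaces.linear scaleC scaleC f" "inj f"
  shows "bij f"
proof -
  obtain S where S: "complex_vector.independent S" "complex_vector.span S = (UNIV :: 'w set)"
    using complex_vector.maximal_independent_subset[of UNIV] by (metis top.extremum_uniqueI)
  have "finite S"
    using fin S(1) complex_vector.independent_span_bound unfolding finite_cdim_def by blast
  with S interpret W: finite_dimensional_vector_space "scaleC :: complex \<Rightarrow> 'w \<Rightarrow> 'w" S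
    by unfold_locales auto
  show ?thesis
    using W.linear_inj_imp_surj f by (simp add: bij_def)
qed

text \<open>A basis of \<open>V\<close> is carried to a basis of the image with the same
  cardinality. Finiteness is transported from the image back to \<open>V\<close>, the direction in
  which it is used for the first projection.\<close>

lemma dim_linear_image_inj_on:
  fixes f :: "'a :: complex_inner \<Rightarrow> 'b :: complex_inner"
  assumes f: "Vector_Spaces.linear scaleC scaleC f" and inj: "inj_on f V"
    and V: "complex_vector.subspace V"
  shows "complex_vector.dim (f ` V) = complex_vector.dim V"
    and "finite_cdim (f ` V) \<Longrightarrow> finite_cdim V"
proof -
  interpret vector_space_pair "scaleC :: complex \<Rightarrow> 'a \<Rightarrow> 'a" "scaleC :: complex \<Rightarrow> 'b \<Rightarrow> 'b"
    by (rule vector_space_pair_scaleC)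
  obtain S where S: "S \<subseteq> V" "complex_vector.independent S" "V \<subseteq> complex_vector.span S"
    by (rule complex_vector.maximal_independent_subset)
  have span: "complex_vector.span S = V"
    using S(3) complex_vector.span_minimal[OF S(1) V] by (rule equalityI[rotated])
  have ind: "complex_vector.independent (f ` S)"
    by (rule linear_independent_injective_image[OF f S(2)]) (simp add: span inj)
  have sub: "f ` V \<subseteq> complex_vector.span (f ` S)"
    using linear_span_image[OF f, of S] by (simp add: span)
  have card: "card (f ` S) = card S"
    by (meson S(1) card_image inj inj_on_subset)
  show "complex_vector.dim (f ` V) = complex_vector.dim V"
    using complex_vector.dim_unique[OF S(1) S(3) S(2) refl]
      complex_vector.dim_unique[OF image_mono[OF S(1)] sub ind card] by simp
  show "finite_cdim V" if fin: "finite_cdim (f ` V)"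
  proof -
    obtain b where b: "finite b" "f ` V \<subseteq> complex_vector.span b"
      using fin unfolding finite_cdim_def by blast
    then have "finite (f ` S)"
      using complex_vector.independent_span_bound[OF b(1) ind] image_mono[OF S(1), of f]
      by (meson order_trans)
    then have "finite S"
      by (meson S(1) finite_imageD inj inj_on_subset)
    then show ?thesis
      using S(3) unfolding finite_cdim_def by blast
  qed
qed

text \<open>Eigenvalues of a self-adjoint map are real, so the shift by a non-real \<open>c\<close>
  is injective, hence bijective in finite dimension.\<close>

lemma selfadjoint_map_shift_bij:
  fixes B :: "'w :: complex_inner \<Rightarrow> 'w"
  assumes fin: "finite_cdim (UNIV :: 'w set)" and B: "selfadjoint_map B" and c: "c \<notin> \<real>"
  shows "bij (\<lambda>b. B b - c *\<^sub>C b)"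
proof (rule linear_inj_imp_bij_finite_cdim[OF fin])
  have lin: "B (x + y) = B x + B y" "B (d *\<^sub>C x) = d *\<^sub>C B x" for x y d
    using B by (simp_all add: selfadjoint_map_def linear_scaleC_iff)
  show lin': "Vector_Spaces.linear scaleC scaleC (\<lambda>b. B b - c *\<^sub>C b)"
    by (simp add: linear_scaleC_iff lin scaleC_add_right scaleC_scaleC mult.commute
        complex_vector.scale_right_diff_distrib)
  interpret vector_space_pair "scaleC :: complex \<Rightarrow> 'w \<Rightarrow> 'w" "scaleC :: complex \<Rightarrow> 'w \<Rightarrow> 'w"
    by (rule vector_space_pair_scaleC)
  have "b = 0" if "B b - c *\<^sub>C b = 0" for b
  proof -
    have "cinner (B b) b = cinner b (B b)"
      using B by (simp add: selfadjoint_map_def)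
    \<comment> \<open>Inserting \<open>B b = c *\<^sub>C b\<close> on both sides gives
      \<open>c\<close> on the left and, by antilinearity in the second argument,
      \<open>cnj c\<close> on the right.\<close>
    with that have "(c - cnj c) * cinner b b = 0"
      by (simp add: cinner_scaleC_left cinner_scaleC_right left_diff_distrib)
    moreover have "cnj c \<noteq> c"
      using c by (simp add: Reals_cnj_iff)
    ultimately show ?thesis
      by auto
  qed
  then show "inj (\<lambda>b. B b - c *\<^sub>C b)"
    by (subst linear_inj_iff_eq_0[OF lin']) blast
qed


section \<open>Adjoints\<close>

text \<open>For the minimal operator a trivial orthogonal complement of the domain is easier to verify
  than density, and it already makes the adjoint single-valued.\<close>

lemma adjoint_op_eq_Some_iff:
  assumes total: "\<forall>z. (\<forall>x\<in>dom T. cinner x z = 0) \<longrightarrow> z = 0"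
  shows "adjoint_op T y = Some z \<longleftrightarrow> (\<forall>x\<in>dom T. cinner (the (T x)) y = cinner x z)"
proof -
  have unique: "z = z'"
    if "\<forall>x\<in>dom T. cinner (the (T x)) y = cinner x z" "\<forall>x\<in>dom T. cinner (the (T x)) y = cinner x z'"
    for z z'
    using total[rule_format, of "z - z'"] that by (simp add: cinner_diff_right)
  have the: "(THE z. \<forall>x\<in>dom T. cinner (the (T x)) y = cinner x z) = z"
    if "\<forall>x\<in>dom T. cinner (the (T x)) y = cinner x z" for z
    using that unique by (intro the_equality) blast+
  show ?thesis
  proof (cases "\<exists>z. \<forall>x\<in>dom T. cinner (the (T x)) y = cinner x z")
    case True
    then obtain z' where z': "\<forall>x\<in>dom T. cinner (the (T x)) y = cinner x z'"
      by blast
    then have "adjoint_op T y = Some z'"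
      using True by (simp only: adjoint_op_def the if_True)
    then show ?thesis
      using z' unique by (metis option.inject)
  next
    case False
    then show ?thesis
      by (auto simp only: adjoint_op_def if_False)
  qed
qed

text \<open>This form tests \<open>y\<close> directly against \<open>T\<close>; closure under sums
  and multiples can be read off from it.\<close>

lemma eigenspace_adjoint_op:
  assumes total: "\<forall>z. (\<forall>x\<in>dom T. cinner x z = 0) \<longrightarrow> z = 0"
  shows "eigenspace_op (adjoint_op T) c = {y. \<forall>x\<in>dom T. cinner (the (T x)) y = cinner x (c *\<^sub>C y)}"
proof -
  have "y \<in> eigenspace_op (adjoint_op T) c \<longleftrightarrow> adjoint_op T y = Some (c *\<^sub>C y)" for y
    by (auto simp: eigenspace_op_def)
  then show ?thesis
    using adjoint_op_eq_Some_iff[OF total] by blast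
qed

lemma subspace_eigenspace_adjoint_op:
  assumes total: "\<forall>z. (\<forall>x\<in>dom T. cinner x z = 0) \<longrightarrow> z = 0"
  shows "complex_vector.subspace (eigenspace_op (adjoint_op T) c)"
  unfolding eigenspace_adjoint_op[OF total]
  by (auto simp: complex_vector.subspace_def cinner_add_right cinner_scaleC_right distrib_left)

lemma densely_defined_total:
  "densely_defined T \<Longrightarrow> \<forall>z. (\<forall>x\<in>dom T. cinner x z = 0) \<longrightarrow> z = 0"
  unfolding densely_defined_def by (blast intro: orthogonal_to_dense_eq_0)

text \<open>The right-hand side satisfies the defining relation of the adjoint: the second argument
  is antilinear on both sides, so each coefficient is conjugated in the same way.\<close>

lemma adjoint_op_sum:
  assumes T: "densely_defined T"
    and s: "s \<in> dom (adjoint_op T)" and t: "\<And>j. j \<in> A \<Longrightarrow> t j \<in> dom (adjoint_op T)"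
  shows "adjoint_op T (s + (\<Sum>j\<in>A. \<alpha> j *\<^sub>C t j)) =
    Some (the (adjoint_op T s) + (\<Sum>j\<in>A. \<alpha> j *\<^sub>C the (adjoint_op T (t j))))"
proof -
  note iff = adjoint_op_eq_Some_iff[OF densely_defined_total[OF T]]
  have adj: "cinner (the (T x)) y = cinner x (the (adjoint_op T y))"
    if "x \<in> dom T" "y \<in> dom (adjoint_op T)" for x y
    using that iff by (metis domD option.sel)
  show ?thesis
    unfolding iff
    by (intro ballI)
      (simp add: cinner_add_right cinner_sum_right cinner_scaleC_right adj s t del: domIff)
qed

text \<open>Symmetry is the defining relation of the adjoint with \<open>z\<close> the value of
  \<open>T\<close> at \<open>x\<close>.\<close>

lemma symmetric_op_le_adjoint_op:
  assumes "symmetric_op T" and "x \<in> dom T"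
  shows "adjoint_op T x = Some (the (T x))"
  using assms by (simp add: symmetric_op_def adjoint_op_eq_Some_iff[OF densely_defined_total])


section \<open>The extended operators\<close>

text \<open>Two decompositions of the same vector differ by a combination of the \<open>t j\<close>
  lying in \<open>dom T0\<close>; independence modulo \<open>dom T0\<close> makes the coefficients
  agree, so the description in \<open>Psi\<close> is unique.\<close>

lemma Psi_decomposition:
  assumes T0: "linear_op T0" and GKN: "partial_GKN T0 T1 n t" and s: "s \<in> dom T0"
  shows "Psi T0 n t \<xi> (s + (\<Sum>j=1..n. \<alpha> j *\<^sub>C t j)) = (\<Sum>j=1..n. \<alpha> j *\<^sub>C \<xi> j)"
  unfolding Psi_def
proof (rule the_equality)
  fix w
  assume "\<exists>s'\<in>dom T0. \<exists>\<beta>. s + (\<Sum>j=1..n. \<alpha> j *\<^sub>C t j) = s' + (\<Sum>j=1..n. \<beta> j *\<^sub>C t j) \<and>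
    w = (\<Sum>j=1..n. \<beta> j *\<^sub>C \<xi> j)"
  then obtain s' \<beta> where s': "s' \<in> dom T0"
      and eq: "s + (\<Sum>j=1..n. \<alpha> j *\<^sub>C t j) = s' + (\<Sum>j=1..n. \<beta> j *\<^sub>C t j)"
      and w: "w = (\<Sum>j=1..n. \<beta> j *\<^sub>C \<xi> j)"
    by blast
  have "(\<Sum>j=1..n. (\<alpha> j - \<beta> j) *\<^sub>C t j) = s' - s"
    using eq by (simp add: complex_vector.scale_left_diff_distrib sum_subtractf algebra_simps)
  also have "\<dots> \<in> dom T0"
    using T0 s s' by (simp add: linear_op_def complex_vector.subspace_diff)
  finally have "\<forall>j\<in>{1..n}. \<alpha> j - \<beta> j = 0"
    using GKN[unfolded partial_GKN_def, THEN conjunct2, THEN conjunct1, rule_format, of "\<lambda>j. \<alpha> j - \<beta> j"]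
    by blast
  then show "w = (\<Sum>j=1..n. \<alpha> j *\<^sub>C \<xi> j)"
    unfolding w by (intro sum.cong) auto
qed (use s in blast)

text \<open>Eliminates \<open>Psi\<close>: the domain is parametrised by \<open>s\<close> and the
  coefficients \<alpha>, which serve as free test data below.\<close>

lemma minimal_op_graph:
  assumes "linear_op T0" and "partial_GKN T0 T1 n t"
  shows "dom (minimal_op T0 T1 n t \<xi> B) =
      {(s + (\<Sum>j=1..n. \<alpha> j *\<^sub>C t j), \<Sum>j=1..n. \<alpha> j *\<^sub>C \<xi> j) | s \<alpha>. s \<in> dom T0}"
    and "u \<in> dom (minimal_op T0 T1 n t \<xi> B) \<Longrightarrow>
      the (minimal_op T0 T1 n t \<xi> B u) = (the (T1 (fst u)), B (snd u))"
proof -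
  have Psi_image: "{(s + (\<Sum>j=1..n. \<alpha> j *\<^sub>C t j), Psi T0 n t \<xi> (s + (\<Sum>j=1..n. \<alpha> j *\<^sub>C t j))) |
        s \<alpha>. s \<in> dom T0} =
      {(s + (\<Sum>j=1..n. \<alpha> j *\<^sub>C t j), \<Sum>j=1..n. \<alpha> j *\<^sub>C \<xi> j) | s \<alpha>. s \<in> dom T0}"
    by (intro Collect_cong iff_exI)
      (simp add: Psi_decomposition[OF assms] del: domIff One_nat_def cong: rev_conj_cong)
  have "dom (minimal_op T0 T1 n t \<xi> B) = {(x, Psi T0 n t \<xi> x) | x. x \<in> Delta0 T0 n t}"
    by (auto simp: minimal_op_def dom_def split: if_splits)
  also have "Delta0 T0 n t = {s + (\<Sum>j=1..n. \<alpha> j *\<^sub>C t j) | s \<alpha>. s \<in> dom T0}"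
    unfolding Delta0_def span_image_eq_sums[OF finite_atLeastAtMost] by blast
  also have "{(x, Psi T0 n t \<xi> x) | x. x \<in> {s + (\<Sum>j=1..n. \<alpha> j *\<^sub>C t j) | s \<alpha>. s \<in> dom T0}} =
      {(s + (\<Sum>j=1..n. \<alpha> j *\<^sub>C t j), Psi T0 n t \<xi> (s + (\<Sum>j=1..n. \<alpha> j *\<^sub>C t j))) | s \<alpha>. s \<in> dom T0}"
    by blast
  finally show "dom (minimal_op T0 T1 n t \<xi> B) =
      {(s + (\<Sum>j=1..n. \<alpha> j *\<^sub>C t j), \<Sum>j=1..n. \<alpha> j *\<^sub>C \<xi> j) | s \<alpha>. s \<in> dom T0}"
    unfolding Psi_image .
  show "the (minimal_op T0 T1 n t \<xi> B u) = (the (T1 (fst u)), B (snd u))"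
    if "u \<in> dom (minimal_op T0 T1 n t \<xi> B)"
    using that by (auto simp: minimal_op_def dom_def split: if_splits prod.splits)
qed

text \<open>Supplies the hypothesis under which the adjoint of the minimal operator is
  single-valued. Zero coefficients give the test vectors \<open>(s, 0)\<close>, which kill the first
  component by density of \<open>dom T0\<close>.\<close>

lemma minimal_op_dom_total:
  assumes T0: "symmetric_op T0" and GKN: "partial_GKN T0 T1 n t"
    and \<xi>: "orthonormal_basis n \<xi>"
  shows "\<forall>z. (\<forall>u\<in>dom (minimal_op T0 T1 n t \<xi> B). cinner u z = 0) \<longrightarrow> z = 0"
proof (intro allI impI)
  fix z
  assume orth: "\<forall>u\<in>dom (minimal_op T0 T1 n t \<xi> B). cinner u z = 0"
  have lin: "linear_op T0"
    using T0 by (simp add: symmetric_op_def)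
  have *: "cinner (s + (\<Sum>j=1..n. \<alpha> j *\<^sub>C t j)) (fst z) + cinner (\<Sum>j=1..n. \<alpha> j *\<^sub>C \<xi> j) (snd z) = 0"
    if "s \<in> dom T0" for s \<alpha>
  proof -
    have "cinner (s + (\<Sum>j=1..n. \<alpha> j *\<^sub>C t j), \<Sum>j=1..n. \<alpha> j *\<^sub>C \<xi> j) z = 0"
      by (rule orth[rule_format], unfold minimal_op_graph(1)[OF lin GKN], rule CollectI)
        (rule exI[of _ s], rule exI[of _ \<alpha>], simp only: that simp_thms)
    then show ?thesis
      by (simp add: cinner_prod_def)
  qed
  have "cinner s (fst z) = 0" if "s \<in> dom T0" for s
    using *[OF that, of "\<lambda>_. 0"] by simp
  moreover have "densely_defined T0"
    using T0 by (simp add: symmetric_op_def)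
  ultimately have z1: "fst z = 0"
    using densely_defined_total[of T0] by blast
  \<comment> \<open>Once \<open>fst z = 0\<close>, the \<open>t j\<close> parts of the test vectors
    contribute nothing, so \<open>s = 0\<close> leaves every combination of the
    \<open>\<xi> j\<close> to test \<open>snd z\<close>.\<close>
  have "0 \<in> dom T0"
    using lin by (simp add: linear_op_def complex_vector.subspace_0)
  then have \<xi>_orth: "cinner (\<Sum>j=1..n. \<alpha> j *\<^sub>C \<xi> j) (snd z) = 0" for \<alpha>
    using *[of 0 \<alpha>] by (simp only: z1 cinner_zero_right add_0)
  have "cinner (\<xi> k) (snd z) = 0" if "k \<in> {1..n}" for k
    using \<xi>_orth[of "\<lambda>j. if j = k then 1 else 0"]
    unfolding sum_delta_scaleC[OF finite_atLeastAtMost that] .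
  then have "snd z = 0"
    by (rule orthogonal_to_orthonormal_basis_eq_0[OF \<xi>])
  with z1 show "z = 0"
    by (simp add: prod_eq_iff)
qed

section \<open>The adjoint of the minimal operator\<close>

text \<open>Orthonormality extracts the coefficient of \<open>\<xi> j\<close>, conjugated because it
  stands in the second argument; the bracket is skew-Hermitian, which turns the conjugate into a
  sign and a swap.\<close>

lemma cinner_Omega:
  assumes "orthonormal_basis n \<xi>" and "j \<in> {1..n}"
  shows "cinner (\<xi> j) (Omega T1 n t \<xi> y) = - bracket T1 (t j) y"
proof -
  have "cinner (\<xi> j) (Omega T1 n t \<xi> y) = (\<Sum>k=1..n. if j = k then cnj (bracket T1 y (t k)) else 0)"
    unfolding Omega_def cinner_sum_right using assms
    by (intro sum.cong) (simp_all add: cinner_scaleC_right orthonormal_basis_cinner)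
  also have "\<dots> = cnj (bracket T1 y (t j))"
    using assms(2) by simp
  also have "\<dots> = - bracket T1 (t j) y"
    by (simp add: bracket_def cinner_commute[symmetric])
  finally show ?thesis .
qed

lemma adjoint_minimal_op:
  fixes \<xi> :: "nat \<Rightarrow> 'w :: complex_inner"
  assumes T0: "symmetric_op T0" and T1: "T1 = adjoint_op T0"
    and GKN: "partial_GKN T0 T1 n t" and \<xi>: "orthonormal_basis n \<xi>" and B: "selfadjoint_map B"
  shows "adjoint_op (minimal_op T0 T1 n t \<xi> B) = maximal_op T1 n t \<xi> B"
proof -
  have lin: "linear_op T0" and dense: "densely_defined T0"
    using T0 by (simp_all add: symmetric_op_def)
  \<comment> \<open>\<open>T0\<close> may be replaced by \<open>T1\<close> in the relation since
    both agree on \<open>dom T0\<close>; the minimal operator is itself written with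
    \<open>T1\<close>.\<close>
  have T1_iff: "T1 y = Some z \<longleftrightarrow> (\<forall>x\<in>dom T0. cinner (the (T1 x)) y = cinner x z)" for y z
    by (simp add: T1 symmetric_op_le_adjoint_op[OF T0]
        adjoint_op_eq_Some_iff[OF densely_defined_total[OF dense]] del: domIff cong: ball_cong)
  have s_T1: "s \<in> dom T1" if "s \<in> dom T0" for s
    using symmetric_op_le_adjoint_op[OF T0 that] T1 by auto
  have t_T1: "t j \<in> dom T1" if "j \<in> {1..n}" for j
    using GKN that by (simp add: partial_GKN_def)
  have T1_sum: "T1 (s + (\<Sum>j=1..n. \<alpha> j *\<^sub>C t j)) = Some (the (T1 s) + (\<Sum>j=1..n. \<alpha> j *\<^sub>C the (T1 (t j))))"
    if "s \<in> dom T0" for s \<alpha>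
    unfolding T1
  proof (rule adjoint_op_sum[OF dense])
    show "s \<in> dom (adjoint_op T0)"
      using s_T1[OF that] unfolding T1 .
    show "t j \<in> dom (adjoint_op T0)" if "j \<in> {1..n}" for j
      using t_T1[OF that] unfolding T1 .
  qed
  have Bsym: "cinner (B a) b = cinner a (B b)" for a b
    using B by (simp add: selfadjoint_map_def)
  \<comment> \<open>The relation is expanded on a general element of the domain and sorted by the
    coefficients \<open>\<alpha> j\<close>; self-adjointness has moved \<open>B\<close> onto
    \<open>b\<close>.\<close>
  have adj_iff: "adjoint_op (minimal_op T0 T1 n t \<xi> B) (y, b) = Some (z, c) \<longleftrightarrow>
      (\<forall>s\<in>dom T0. \<forall>\<alpha>.
        cinner (the (T1 s)) y + (\<Sum>j=1..n. \<alpha> j * (cinner (the (T1 (t j))) y + cinner (\<xi> j) (B b))) =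
        cinner s z + (\<Sum>j=1..n. \<alpha> j * (cinner (t j) z + cinner (\<xi> j) c)))" for y b z c
  proof -
    have "adjoint_op (minimal_op T0 T1 n t \<xi> B) (y, b) = Some (z, c) \<longleftrightarrow>
      (\<forall>u\<in>dom (minimal_op T0 T1 n t \<xi> B). cinner (the (minimal_op T0 T1 n t \<xi> B u)) (y, b) = cinner u (z, c))"
      by (rule adjoint_op_eq_Some_iff[OF minimal_op_dom_total[OF T0 GKN \<xi>]])
    also have "\<dots> \<longleftrightarrow> (\<forall>u\<in>dom (minimal_op T0 T1 n t \<xi> B).
        cinner (the (T1 (fst u))) y + cinner (snd u) (B b) = cinner (fst u) z + cinner (snd u) c)"
      by (rule ball_cong[OF refl])
        (simp only: minimal_op_graph(2)[OF lin GKN] cinner_prod_def fst_conv snd_conv Bsym)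
    also have "\<dots> \<longleftrightarrow> (\<forall>s\<in>dom T0. \<forall>\<alpha>.
        cinner (the (T1 (s + (\<Sum>j=1..n. \<alpha> j *\<^sub>C t j)))) y + cinner (\<Sum>j=1..n. \<alpha> j *\<^sub>C \<xi> j) (B b) =
        cinner (s + (\<Sum>j=1..n. \<alpha> j *\<^sub>C t j)) z + cinner (\<Sum>j=1..n. \<alpha> j *\<^sub>C \<xi> j) c)"
      unfolding minimal_op_graph(1)[OF lin GKN] by fastforce
    also have "\<dots> \<longleftrightarrow> (\<forall>s\<in>dom T0. \<forall>\<alpha>.
        cinner (the (T1 s)) y + (\<Sum>j=1..n. \<alpha> j * (cinner (the (T1 (t j))) y + cinner (\<xi> j) (B b))) =
        cinner s z + (\<Sum>j=1..n. \<alpha> j * (cinner (t j) z + cinner (\<xi> j) c)))"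
      by (intro ball_cong[OF refl])
        (simp add: T1_sum cinner_add_left cinner_sum_left cinner_scaleC_left distrib_left
          sum.distrib add.assoc del: One_nat_def)
    finally show ?thesis .
  qed
  have max_iff: "maximal_op T1 n t \<xi> B (y, b) = Some (z, c) \<longleftrightarrow> T1 y = Some z \<and> c = B b - Omega T1 n t \<xi> y"
    for y b z c
    by (auto simp: maximal_op_def)
  have "adjoint_op (minimal_op T0 T1 n t \<xi> B) (y, b) = Some (z, c) \<longleftrightarrow>
      maximal_op T1 n t \<xi> B (y, b) = Some (z, c)" for y b z c
  proof
    assume "adjoint_op (minimal_op T0 T1 n t \<xi> B) (y, b) = Some (z, c)"
    note eq = this[unfolded adj_iff, rule_format]
    \<comment> \<open>Zero coefficients leave exactly the relation that defines \<open>T1\<close> at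
      \<open>y\<close>.\<close>
    have y: "T1 y = Some z"
      unfolding T1_iff using eq[of _ "\<lambda>_. 0"] by simp
    \<comment> \<open>Taking \<open>s = 0\<close> and Kronecker coefficients isolates the index
      \<open>j\<close>; with \<open>z\<close> the value of \<open>T1\<close> at \<open>y\<close>,
      the \<open>H\<close> terms combine to \<open>bracket T1 (t j) y\<close>, which the
      contribution of \<open>Omega\<close> cancels.\<close>
    have "c - (B b - Omega T1 n t \<xi> y) = 0"
    proof (rule orthogonal_to_orthonormal_basis_eq_0[OF \<xi>])
      fix j
      assume j: "j \<in> {1..n}"
      have "0 \<in> dom T0"
        using lin by (simp add: linear_op_def complex_vector.subspace_0)
      moreover have "the (T1 0) = 0"
        using T1_iff[of 0 0] by simp
      ultimately have "cinner (the (T1 (t j))) y + cinner (\<xi> j) (B b) = cinner (t j) z + cinner (\<xi> j) c"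
        using eq[of 0 "\<lambda>k. if k = j then 1 else 0"] unfolding sum_delta_mult[OF finite_atLeastAtMost j]
        by simp
      then show "cinner (\<xi> j) (c - (B b - Omega T1 n t \<xi> y)) = 0"
        unfolding cinner_diff_right cinner_Omega[OF \<xi> j] bracket_def y option.sel
        by (simp add: algebra_simps)
    qed
    then show "maximal_op T1 n t \<xi> B (y, b) = Some (z, c)"
      by (simp add: max_iff y)
  next
    assume "maximal_op T1 n t \<xi> B (y, b) = Some (z, c)"
    then have y: "T1 y = Some z" and c: "c = B b - Omega T1 n t \<xi> y"
      by (simp_all add: max_iff)
    show "adjoint_op (minimal_op T0 T1 n t \<xi> B) (y, b) = Some (z, c)"
      unfolding adj_iff
    \<comment> \<open>Conversely, the two sides agree summand by summand: the \<open>s\<close> terms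
      by the relation for \<open>T1\<close>, each \<open>j\<close> term by the bracket
      identity.\<close>
    proof (intro ballI allI arg_cong2[of _ _ _ _ "(+)"] sum.cong refl)
      show "cinner (the (T1 s)) y = cinner s z" if "s \<in> dom T0" for s
        using y that unfolding T1_iff by blast
      show "\<alpha> j * (cinner (the (T1 (t j))) y + cinner (\<xi> j) (B b)) =
          \<alpha> j * (cinner (t j) z + cinner (\<xi> j) c)" if "j \<in> {1..n}" for j and \<alpha> :: "nat \<Rightarrow> complex"
        by (simp add: c cinner_diff_right cinner_Omega[OF \<xi> that] bracket_def y)
    qed
  qed
  then have Some_iff: "adjoint_op (minimal_op T0 T1 n t \<xi> B) u = Some v \<longleftrightarrow>
      maximal_op T1 n t \<xi> B u = Some v" for u v
    by (cases u; cases v) blast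
  \<comment> \<open>Agreement on all \<open>Some\<close> values also forces agreement where a value
    is \<open>None\<close>, so the domains coincide.\<close>
  show ?thesis
  proof
    show "adjoint_op (minimal_op T0 T1 n t \<xi> B) u = maximal_op T1 n t \<xi> B u" for u
      using Some_iff[of u] by (metis not_None_eq)
  qed
qed

section \<open>Eigenspaces and deficiency indices\<close>

lemma eigenspace_maximal_op_iff:
  assumes "bij (\<lambda>b. B b - c *\<^sub>C b)"
  shows "(x, a) \<in> eigenspace_op (maximal_op T1 n t \<xi> B) c \<longleftrightarrow>
    x \<in> eigenspace_op T1 c \<and> a = inv (\<lambda>b. B b - c *\<^sub>C b) (Omega T1 n t \<xi> x)"
proof -
  have "(x, a) \<in> eigenspace_op (maximal_op T1 n t \<xi> B) c \<longleftrightarrow>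
      x \<in> eigenspace_op T1 c \<and> B a - Omega T1 n t \<xi> x = c *\<^sub>C a"
    by (auto simp: eigenspace_op_def maximal_op_def scaleC_prod_def dom_def split: if_splits)
  also have "B a - Omega T1 n t \<xi> x = c *\<^sub>C a \<longleftrightarrow> B a - c *\<^sub>C a = Omega T1 n t \<xi> x"
    by (metis add_diff_cancel diff_add_cancel add.commute)
  also have "\<dots> \<longleftrightarrow> a = inv (\<lambda>b. B b - c *\<^sub>C b) (Omega T1 n t \<xi> x)"
    using bij_inv_eq_iff[OF assms] by metis
  finally show ?thesis .
qed

text \<open>The bijectivity claims give \<open>inv\<close> its meaning as the inverse of
  \<open>B\<close> shifted by \<open>\<i>\<close> or \<open>- \<i>\<close>. The identity for the
  adjoint links the deficiency indices of \<open>That0\<close>, defined through its adjoint, to the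
  eigenspaces of \<open>That1\<close>.\<close>

theorem lemma4p1:
  fixes T0 T1 :: "'h :: complex_hilbert \<rightharpoonup> 'h"
    and \<xi> :: "nat \<Rightarrow> 'w :: complex_inner"
    and t :: "nat \<Rightarrow> 'h"
    and B :: "'w \<Rightarrow> 'w"
    and n :: nat
  assumes "closed_op T0" and "symmetric_op T0"
    and "equal_finite_deficiency T0" and "deficiency T0 \<ge> 1"
    and "T1 = adjoint_op T0"
    and "finite_cdim (UNIV :: 'w set)"
    and "n = complex_vector.dim (UNIV :: 'w set)" and "n \<le> deficiency T0"
    and "orthonormal_basis n \<xi>"
    and "partial_GKN T0 T1 n t"
    and "selfadjoint_map B"
  defines "That0 \<equiv> minimal_op T0 T1 n t \<xi> B"
    and "That1 \<equiv> maximal_op T1 n t \<xi> B"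
  shows "adjoint_op That0 = That1 \<and>
    bij (\<lambda>b. B b - \<i> *\<^sub>C b) \<and> bij (\<lambda>b. B b + \<i> *\<^sub>C b) \<and>
    (\<forall>x a. (x, a) \<in> eigenspace_op That1 \<i> \<longleftrightarrow>
       x \<in> eigenspace_op T1 \<i> \<and> a = inv (\<lambda>b. B b - \<i> *\<^sub>C b) (Omega T1 n t \<xi> x)) \<and>
    (\<forall>x a. (x, a) \<in> eigenspace_op That1 (- \<i>) \<longleftrightarrow>
       x \<in> eigenspace_op T1 (- \<i>) \<and> a = inv (\<lambda>b. B b + \<i> *\<^sub>C b) (Omega T1 n t \<xi> x)) \<and>
    equal_finite_deficiency That0 \<and> deficiency That0 = deficiency T0"
proof -
  have bij: "bij (\<lambda>b. B b - c *\<^sub>C b)" if "c = \<i> \<or> c = - \<i>" for c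
    using that assms by (intro selfadjoint_map_shift_bij) (auto simp: complex_is_Real_iff)
  have adj: "adjoint_op That0 = That1"
    unfolding That0_def That1_def using assms by (intro adjoint_minimal_op)
  have eig: "(x, a) \<in> eigenspace_op That1 c \<longleftrightarrow>
      x \<in> eigenspace_op T1 c \<and> a = inv (\<lambda>b. B b - c *\<^sub>C b) (Omega T1 n t \<xi> x)"
    if "c = \<i> \<or> c = - \<i>" for x a c
    unfolding That1_def by (rule eigenspace_maximal_op_iff[OF bij[OF that]])
  have dim: "complex_vector.dim (eigenspace_op That1 c) = complex_vector.dim (eigenspace_op T1 c) \<and>
      (finite_cdim (eigenspace_op T1 c) \<longrightarrow> finite_cdim (eigenspace_op That1 c))"
    if c: "c = \<i> \<or> c = - \<i>" for c
  proof -
    have fst: "Vector_Spaces.linear scaleC scaleC (fst :: 'h \<times> 'w \<Rightarrow> 'h)"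
      by (simp add: linear_scaleC_iff scaleC_prod_def)
    \<comment> \<open>Every eigenvector of \<open>T1\<close> has a lift, its second component being
      given by the inverse; this component is determined by \<open>x\<close>, whence injectivity
      below.\<close>
    have img: "fst ` eigenspace_op That1 c = eigenspace_op T1 c"
      using eig[OF c] by force
    have inj: "inj_on fst (eigenspace_op That1 c)"
      using eig[OF c] by (auto intro!: inj_onI)
    \<comment> \<open>Linearity comes from viewing \<open>That1\<close> as the adjoint of
      \<open>That0\<close>.\<close>
    have sub: "complex_vector.subspace (eigenspace_op That1 c)"
      unfolding adj[symmetric] That0_def using minimal_op_dom_total assms
      by (intro subspace_eigenspace_adjoint_op) blast
    show ?thesis
      using dim_linear_image_inj_on[OF fst inj sub] by (simp add: img)
  qed
  \<comment> \<open>For \<open>c = - \<i>\<close> the map \<open>B b - c *\<^sub>C b\<close> becomes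
    \<open>B b + \<i> *\<^sub>C b\<close>, the form in the claim.\<close>
  show ?thesis
    using adj bij[of \<i>] bij[of "- \<i>"] eig[of \<i>] eig[of "- \<i>"] dim[of \<i>] dim[of "- \<i>"] assms(3,5)
    by (simp add: equal_finite_deficiency_def deficiency_def)
qed

end
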